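(* Let $k\ge 1$ be a positive integer, and let $n\ge 1$ be an integer. (1) If $k$ is odd, then $$\sum_{j=-k}^{k-1}(-1)^j\,j\,p\big(n-j(3j+1)/2\big)\ge d_{1,3}(n)-d_{2,3}(n).$$ (2) If $k$ is even, then $$\sum_{j=-k}^{k-1}(-1)^j\,j\,p\big(n-j(3j+1)/2\big)\le d_{1,3}(n)-d_{2,3}(n).$$
   Context: $p(m)$ denotes the number of partitions of the integer $m$ (non-increasing finite sequences of positive integers with sum $m$), with $p(0)=1$ and $p(m)=0$ for $m<0$. For $r\in\{1,2\}$, $d_{r,3}(n)$ is the number of positive divisors of $n$ that are congruent to $r$ modulo $3$. *)

theory Defs
  imports "HOL-Number_Theory.Cong"
begin

definition partitions :: "int \<Rightarrow> nat list set" where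
  "partitions m = {xs. sorted_wrt (\<ge>) xs \<and> (\<forall>x\<in>set xs. x > 0) \<and> int (sum_list xs) = m}"

definition partition_number :: "int \<Rightarrow> nat" where
  "partition_number m = card (partitions m)"

text \<open>Finiteness guards against the convention that infinite sets have cardinality 0.\<close>

lemma finite_partitions: "finite (partitions m)"
proof (rule finite_subset)
  have len: "length xs \<le> sum_list xs" if "\<forall>x\<in>set xs. x > 0" for xs :: "nat list"
    using that by (induction xs) auto
  show "partitions m \<subseteq> {xs. set xs \<subseteq> {..nat m} \<and> length xs \<le> nat m}"
    using len by (force simp: partitions_def dest: member_le_sum_list)
  show "finite {xs. set xs \<subseteq> {..nat m} \<and> length xs \<le> nat m}"
    by (rule finite_lists_length_le) simp
qed

lemma partition_number_0: "partition_number 0 = 1"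
proof -
  have "xs = []" if "\<forall>x\<in>set xs. x > 0" "sum_list xs = 0" for xs :: "nat list"
    using that by (cases xs) auto
  then have "partitions 0 = {[]}"
    by (auto simp: partitions_def)
  then show ?thesis
    by (simp add: partition_number_def)
qed

lemma partition_number_neg: "m < 0 \<Longrightarrow> partition_number m = 0"
  by (auto simp: partition_number_def partitions_def)

definition residue_divisor_count :: "nat \<Rightarrow> nat \<Rightarrow> nat \<Rightarrow> nat" where
  "residue_divisor_count r m n = card {d. d > 0 \<and> d dvd n \<and> [d = r] (mod m)}"

end

theory Submission
  imports Defs "HOL-Computational_Algebra.Formal_Power_Series"
begin

text \<open>
  Differentiating Jacobi's triple product
  \<open>\<Sum>j. (-1) ^ j * z ^ j * q ^ (j * (3 * j + 1) / 2) =
    \<Prod>i. (1 - z * q ^ (3 * i + 2)) * (1 - q ^ (3 * i + 1) / z) * (1 - q ^ (3 * i + 3))\<close>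
  at \<open>z = 1\<close> shows that the full bilateral sum equals \<open>d\<^sub>1 - d\<^sub>2\<close>, so the claim is about the sign of the
  tail. We work with the finite triple product, whose coefficients are Gaussian binomials in \<open>q ^ 3\<close>,
  modulo a power of \<open>q\<close>.

  For the tail, let \<open>G m N\<close> count the partitions of \<open>N\<close> with Dyson rank at least \<open>m\<close>. Dyson's map gives
  \<open>G m N + G (m + 3) (N - m - 1) = p (N - m - 1)\<close>, so tails of the series for \<open>G 0\<close> and \<open>G 1\<close> are shifted
  values of \<open>G (3 * l)\<close> and \<open>G (3 * l + 1)\<close>. Their difference is nonnegative, because enlarging the largest part raises
  the rank. Summation by parts expresses the weighted tail through these differences, and the negative contributions
  telescope to at most one partition number, which the leading term dominates.
\<close>

subsection \<open>Dyson's rank\<close>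

text \<open>Parts are listed in non-increasing order, so \<open>hd xs\<close> is the largest part.
  The value 0 places the empty partition on the low-rank side of Dyson's bijection.\<close>

definition dyson_rank :: "nat list \<Rightarrow> int" where
  "dyson_rank xs = (if xs = [] then 0 else int (hd xs) - int (length xs))"

definition rank_ge_count :: "nat \<Rightarrow> int \<Rightarrow> nat" where
  "rank_ge_count m N = card {xs \<in> partitions N. xs \<noteq> [] \<and> dyson_rank xs \<ge> int m}"

text \<open>Remove the largest part \<open>x\<close> and add a first column of height \<open>x - m - 1\<close> to the Ferrers diagram;
  rank at least \<open>m\<close> says precisely that this column is at least as long as the remaining ones.\<close>

definition dyson_map :: "nat \<Rightarrow> nat list \<Rightarrow> nat list" where
  "dyson_map m xs = map Suc (tl xs) @ replicate (hd xs - Suc m - length (tl xs)) 1"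

text \<open>The height \<open>length ys\<close> of the first column determines the part to restore;
  deleting that column lowers every part by one and drops the ones.\<close>

definition dyson_inv :: "nat \<Rightarrow> nat list \<Rightarrow> nat list" where
  "dyson_inv m ys = (length ys + m + 1) # map (\<lambda>y. y - 1) (filter (\<lambda>y. 1 < y) ys)"

lemma sorted_wrt_ge_replicate: "sorted_wrt (\<ge>) (replicate n (x :: nat))"
  by (induction n) auto

lemma sum_list_map_Suc: "sum_list (map Suc xs) = sum_list xs + length xs"
  by (induction xs) auto

lemma sum_list_map_pred_filter:
  "\<forall>y\<in>set ys. y > 0 \<Longrightarrow>
    sum_list (map (\<lambda>y. y - 1) (filter (\<lambda>y. 1 < y) ys)) + length ys = sum_list (ys :: nat list)"
  by (induction ys) auto

text \<open>Ones form the final segment of a non-increasing list, so \<open>dyson_inv\<close>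
  forgets only how many there are, and the total length recovers this.\<close>

lemma filter_append_replicate_ones:
  "sorted_wrt (\<ge>) ys \<Longrightarrow> \<forall>y\<in>set ys. y > 0 \<Longrightarrow>
    filter (\<lambda>y. 1 < y) ys @ replicate (length ys - length (filter (\<lambda>y. 1 < y) ys)) 1 = (ys :: nat list)"
proof (induction ys)
  case (Cons y ys)
  show ?case
  proof (cases "1 < y")
    case False
    with Cons.prems have "\<forall>z\<in>set (y # ys). z = 1"
      by (force intro: le_antisym)
    then show ?thesis
      using replicate_length_same[of "y # ys" 1] False by (simp add: filter_empty_conv)
  qed (use Cons in auto)
qed simp

text \<open>With \<open>x\<close> the largest part, the image has \<open>x - m - 1\<close> parts,
  none above \<open>x + 1\<close>; hence the rank bound \<open>m + 2\<close>.\<close>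

lemma dyson_map_in_partitions:
  assumes "xs \<in> partitions N" "xs \<noteq> []" "dyson_rank xs \<ge> int m"
  shows "dyson_map m xs \<in> partitions (N - int m - 1)" "dyson_rank (dyson_map m xs) \<le> int m + 2"
    and "dyson_inv m (dyson_map m xs) = xs"
proof -
  obtain x ys where xs: "xs = x # ys"
    using assms(2) by (cases xs) auto
  have x: "x \<ge> Suc m + length ys"
    using assms(3) by (simp add: dyson_rank_def xs)
  have pos: "\<forall>y\<in>set ys. 0 < y" and le: "\<forall>y\<in>set ys. y \<le> x" and "sorted_wrt (\<ge>) ys"
    and sum: "int x + int (sum_list ys) = N"
    using assms(1) by (auto simp: partitions_def xs)
  then show "dyson_map m xs \<in> partitions (N - int m - 1)"
    using x by (auto simp: partitions_def dyson_map_def xs sorted_wrt_append sorted_wrt_map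
        sum_list_map_Suc sum_list_replicate sorted_wrt_ge_replicate)
  show "dyson_rank (dyson_map m xs) \<le> int m + 2"
    using x le by (cases ys) (auto simp: dyson_rank_def dyson_map_def xs hd_append)
  have "filter (\<lambda>y. 0 < y) ys = ys"
    using pos by simp
  then show "dyson_inv m (dyson_map m xs) = xs"
    using x by (simp add: dyson_inv_def dyson_map_def xs filter_map o_def)
qed

lemma dyson_inv_in_partitions:
  assumes "ys \<in> partitions (N - int m - 1)" "dyson_rank ys \<le> int m + 2"
  shows "dyson_inv m ys \<in> partitions N" "dyson_rank (dyson_inv m ys) \<ge> int m"
    and "dyson_map m (dyson_inv m ys) = ys"
proof -
  have sorted: "sorted_wrt (\<ge>) ys" and pos: "\<forall>y\<in>set ys. 0 < y" and sum: "int (sum_list ys) = N - int m - 1"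
    using assms(1) by (auto simp: partitions_def)
  \<comment> \<open>A part \<open>y\<close> becomes \<open>y - 1\<close>, which must not exceed the
    restored part \<open>length ys + m + 1\<close>.\<close>
  have bound: "y \<le> length ys + m + 2" if "y \<in> set ys" for y
  proof -
    have "y \<le> hd ys"
      using that sorted by (cases ys) auto
    moreover have "int (hd ys) \<le> int (length ys) + int m + 2"
      using assms(2) that by (auto simp: dyson_rank_def split: if_splits)
    ultimately show ?thesis
      by linarith
  qed
  have "sorted_wrt (\<ge>) (map (\<lambda>y. y - 1) (filter (\<lambda>y. 1 < y) ys))"
    unfolding sorted_wrt_map
    by (rule sorted_wrt_mono_rel[OF _ sorted_wrt_filter[OF sorted]]) auto
  then show "dyson_inv m ys \<in> partitions N"
    using sum_list_map_pred_filter[OF pos] sum bound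
    by (force simp: partitions_def dyson_inv_def)
  show "dyson_rank (dyson_inv m ys) \<ge> int m"
    by (simp add: dyson_rank_def dyson_inv_def)
  have "map (Suc \<circ> (\<lambda>y. y - 1)) (filter (\<lambda>y. 1 < y) ys) = filter (\<lambda>y. 1 < y) ys"
    by (rule map_idI) auto
  then show "dyson_map m (dyson_inv m ys) = ys"
    using filter_append_replicate_ones[OF sorted pos] by (simp add: dyson_map_def dyson_inv_def)
qed

text \<open>\<open>dyson_map m\<close> is onto the partitions of rank at most \<open>m + 2\<close>;
  the second count supplies those of larger rank.\<close>

lemma rank_ge_count_rec:
  "rank_ge_count m N + rank_ge_count (m + 3) (N - int m - 1) = partition_number (N - int m - 1)"
proof -
  let ?A = "{xs \<in> partitions N. xs \<noteq> [] \<and> dyson_rank xs \<ge> int m}"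
  let ?B = "{ys \<in> partitions (N - int m - 1). dyson_rank ys \<le> int m + 2}"
  let ?C = "{ys \<in> partitions (N - int m - 1). ys \<noteq> [] \<and> dyson_rank ys \<ge> int (m + 3)}"
  have "bij_betw (dyson_map m) ?A ?B"
    using dyson_map_in_partitions dyson_inv_in_partitions
    by (intro bij_betw_byWitness[where f' = "dyson_inv m"]) (auto simp: dyson_inv_def)
  then have "card ?A = card ?B"
    by (rule bij_betw_same_card)
  moreover have "card (?B \<union> ?C) = card ?B + card ?C"
    by (rule card_Un_disjoint) (auto simp: finite_partitions)
  moreover have "?B \<union> ?C = partitions (N - int m - 1)"
    by (auto simp: dyson_rank_def)
  ultimately show ?thesis
    by (simp add: rank_ge_count_def partition_number_def)
qed

text \<open>Adding \<open>d\<close> to the largest part is injective and raises the rank by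
  \<open>d\<close>. The case \<open>d = l\<close> makes \<open>rank_tail l\<close>
  nonnegative.\<close>

lemma rank_ge_count_mono:
  "rank_ge_count (m + 1) (N - int d) \<le> rank_ge_count m N"
  unfolding rank_ge_count_def
proof (rule card_inj_on_le)
  let ?f = "\<lambda>xs. (hd xs + d) # tl xs"
  show "inj_on ?f {xs \<in> partitions (N - int d). xs \<noteq> [] \<and> dyson_rank xs \<ge> int (m + 1)}"
    by (auto simp: inj_on_def intro: list.expand)
  show "?f ` {xs \<in> partitions (N - int d). xs \<noteq> [] \<and> dyson_rank xs \<ge> int (m + 1)}
      \<subseteq> {xs \<in> partitions N. xs \<noteq> [] \<and> dyson_rank xs \<ge> int m}"
    by (auto simp: partitions_def dyson_rank_def neq_Nil_conv intro!: trans_le_add1)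
qed (simp add: finite_partitions)

section \<open>Monotonicity of p, pentagonal numbers and tails of the rank series\<close>

lemma partition_number_mono:
  assumes "M \<le> N"
  shows "partition_number M \<le> partition_number N"
proof (cases "M < 0")
  case False
  let ?f = "\<lambda>xs. xs @ replicate (nat (N - M)) (1::nat)"
  have "card (partitions M) \<le> card (partitions N)"
  proof (rule card_inj_on_le)
    show "inj_on ?f (partitions M)"
      by (simp add: inj_on_def)
    show "?f ` partitions M \<subseteq> partitions N"
      using assms
      by (auto simp: partitions_def sorted_wrt_append sum_list_replicate Suc_le_eq sorted_wrt_ge_replicate)
  qed (rule finite_partitions)
  then show ?thesis
    by (simp add: partition_number_def)
qed (simp add: partition_number_neg)

definition pent :: "int \<Rightarrow> int" where
  "pent j = j * (3 * j + 1) div 2"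

text \<open>The division in \<open>pent\<close> is exact, so comparisons of pentagonal numbers
  reduce to polynomial ones after doubling.\<close>

lemma two_pent: "2 * pent j = j * (3 * j + 1)"
proof -
  have "even (j * (3 * j + 1))"
    by auto
  then show ?thesis
    by (simp add: pent_def)
qed

lemma pent_nonneg: "pent j \<ge> 0"
proof -
  have "0 \<le> j * (3 * j + 1)"
    by (cases "j \<ge> 0") (auto intro: mult_nonpos_nonpos)
  then show ?thesis
    by (simp add: pent_def)
qed

text \<open>Iterating the recurrence for \<open>rank_ge_count\<close> identifies \<open>rank_tail l N\<close> with the tail
  \<open>\<Sum>i>l. (-1) ^ (i - l - 1) * (p (N - pent (- i)) - p (N - pent i))\<close> of the series that counts
  partitions of rank 0.\<close>

definition rank_tail :: "nat \<Rightarrow> int \<Rightarrow> int" where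
  "rank_tail l N = int (rank_ge_count (3 * l) (N - pent (- int l)))
     - int (rank_ge_count (3 * l + 1) (N - pent (- int l) - int l))"

lemma rank_tail_nonneg: "rank_tail l N \<ge> 0"
  unfolding rank_tail_def using rank_ge_count_mono[of "3 * l" "N - pent (- int l)" l] by simp

text \<open>As \<open>pent (- l) + l = pent l\<close>, Dyson's recurrence at \<open>3 * l\<close>
  and \<open>3 * l + 1\<close> advances the two shifts to \<open>pent (- (l + 1))\<close> and
  \<open>pent (l + 1)\<close>.\<close>

lemma rank_tail_rec:
  "rank_tail l N + rank_tail (Suc l) N =
     int (partition_number (N - pent (- int (Suc l)))) - int (partition_number (N - pent (int (Suc l))))"
proof -
  have "pent (- int (Suc l)) = pent (- int l) + 3 * int l + 1"
    "pent (int (Suc l)) = pent (- int l) + 4 * int l + 2"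
    using two_pent[of "- int (Suc l)"] two_pent[of "- int l"] two_pent[of "int (Suc l)"]
    by (simp_all add: algebra_simps)
  then show ?thesis
    using rank_ge_count_rec[of "3 * l" "N - pent (- int l)"]
      rank_ge_count_rec[of "3 * l + 1" "N - pent (- int l) - int l"]
    by (simp add: rank_tail_def algebra_simps flip: of_nat_add)
qed

subsection \<open>Generating functions and Gaussian binomials\<close>

definition bounded_partitions :: "nat \<Rightarrow> int \<Rightarrow> nat list set" where
  "bounded_partitions M m = {xs \<in> partitions m. \<forall>x\<in>set xs. x \<le> M}"

lemma finite_bounded_partitions: "finite (bounded_partitions M m)"
  by (simp add: bounded_partitions_def finite_partitions)

lemma bounded_partitions_0: "bounded_partitions 0 m = (if m = 0 then {[]} else {})"
proof -
  have "xs = []" if "\<forall>x\<in>set xs. 0 < x" "\<forall>x\<in>set xs. x \<le> 0" for xs :: "nat list"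
    using that by (cases xs) auto
  then show ?thesis
    by (auto simp: bounded_partitions_def partitions_def)
qed

lemma bounded_partitions_Suc:
  "bounded_partitions (Suc M) m =
     bounded_partitions M m \<union> Cons (Suc M) ` bounded_partitions (Suc M) (m - int (Suc M))"
proof -
  have "xs \<in> bounded_partitions M m \<or> xs \<in> Cons (Suc M) ` bounded_partitions (Suc M) (m - int (Suc M))"
    if "xs \<in> bounded_partitions (Suc M) m" for xs
  proof (cases "xs \<noteq> [] \<and> hd xs = Suc M")
    case True
    then obtain ys where "xs = Suc M # ys"
      by (cases xs) auto
    with that show ?thesis
      by (auto simp: bounded_partitions_def partitions_def)
  next
    case False
    have "x \<le> M" if "x \<in> set xs" for x
    proof -
      have "x \<le> hd xs" "hd xs \<le> Suc M"
        using that \<open>xs \<in> bounded_partitions (Suc M) m\<close>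
        by (cases xs; auto simp: bounded_partitions_def partitions_def)+
      with False that show ?thesis
        by (cases "xs = []") auto
    qed
    with that show ?thesis
      by (auto simp: bounded_partitions_def)
  qed
  moreover have "bounded_partitions M m \<subseteq> bounded_partitions (Suc M) m"
    by (auto simp: bounded_partitions_def le_Suc_eq)
  moreover have "Cons (Suc M) ` bounded_partitions (Suc M) (m - int (Suc M)) \<subseteq> bounded_partitions (Suc M) m"
    by (auto simp: bounded_partitions_def partitions_def)
  ultimately show ?thesis
    by blast
qed

lemma card_bounded_partitions_Suc:
  "card (bounded_partitions (Suc M) m) =
     card (bounded_partitions M m) + card (bounded_partitions (Suc M) (m - int (Suc M)))"
proof -
  have "bounded_partitions M m \<inter> Cons (Suc M) ` bounded_partitions (Suc M) (m - int (Suc M)) = {}"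
    by (auto simp: bounded_partitions_def)
  then have "card (bounded_partitions M m \<union> Cons (Suc M) ` bounded_partitions (Suc M) (m - int (Suc M))) =
      card (bounded_partitions M m) + card (Cons (Suc M) ` bounded_partitions (Suc M) (m - int (Suc M)))"
    by (intro card_Un_disjoint) (simp_all add: finite_bounded_partitions)
  then show ?thesis
    unfolding bounded_partitions_Suc[of M m, symmetric] by (simp add: card_image)
qed

text \<open>No part exceeds the sum, so bounding the parts by \<open>M\<close> leaves coefficients
  up to degree \<open>M\<close> unchanged.\<close>

lemma card_bounded_partitions:
  assumes "m \<le> int M"
  shows "card (bounded_partitions M m) = partition_number m"
proof -
  have "x \<le> M" if "xs \<in> partitions m" "x \<in> set xs" for x xs
    using member_le_sum_list[OF that(2)] that(1) assms by (auto simp: partitions_def)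
  then have "bounded_partitions M m = partitions m"
    by (auto simp: bounded_partitions_def)
  then show ?thesis
    by (simp add: partition_number_def)
qed

text \<open>The bound makes the inverse a finite product. Over a field, every series with nonzero
  constant term is a unit, as \<open>jtp_even_cong\<close> requires.\<close>

definition partition_fps :: "nat \<Rightarrow> rat fps" where
  "partition_fps M = Abs_fps (\<lambda>n. of_nat (card (bounded_partitions M (int n))))"

text \<open>The q-Pochhammer symbol (q; q)_n, used at both \<open>fps_X\<close> and
  \<open>fps_X ^ 3\<close>.\<close>

definition qpoch :: "'a :: comm_ring_1 \<Rightarrow> nat \<Rightarrow> 'a" where
  "qpoch q n = (\<Prod>i=1..n. 1 - q ^ i)"

lemma qpoch_0 [simp]: "qpoch q 0 = 1"
  and qpoch_Suc [simp]: "qpoch q (Suc n) = qpoch q n * (1 - q ^ Suc n)"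
  by (simp_all add: qpoch_def)

lemma partition_fps_Suc: "(1 - fps_X ^ Suc M) * partition_fps (Suc M) = partition_fps M"
proof (rule fps_ext)
  fix n
  show "fps_nth ((1 - fps_X ^ Suc M) * partition_fps (Suc M)) n = fps_nth (partition_fps M) n"
  proof (cases "n < Suc M")
    case True
    then have "bounded_partitions (Suc M) (int n - int (Suc M)) = {}"
      by (auto simp: bounded_partitions_def partitions_def)
    then have "card (bounded_partitions (Suc M) (int n)) = card (bounded_partitions M (int n))"
      unfolding card_bounded_partitions_Suc[of M "int n"] by simp
    with True show ?thesis
      unfolding left_diff_distrib fps_sub_nth fps_X_power_mult_nth partition_fps_def by simp
  next
    case False
    then have "int (n - Suc M) = int n - int (Suc M)"
      by (intro of_nat_diff) simp
    with False show ?thesis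
      unfolding left_diff_distrib fps_sub_nth fps_X_power_mult_nth partition_fps_def
      using card_bounded_partitions_Suc[of M "int n"] by simp
  qed
qed

lemma partition_fps_times_qpoch: "partition_fps M * qpoch fps_X M = 1"
proof (induction M)
  case 0
  show ?case
    by (rule fps_ext) (simp add: partition_fps_def bounded_partitions_0)
next
  case (Suc M)
  have "partition_fps (Suc M) * qpoch fps_X (Suc M) = ((1 - fps_X ^ Suc M) * partition_fps (Suc M)) * qpoch fps_X M"
    by (simp only: qpoch_Suc mult_ac)
  with Suc show ?case
    by (simp only: partition_fps_Suc)
qed

section \<open>Gaussian binomials without division\<close>

fun gauss_binomial :: "'a :: comm_ring_1 \<Rightarrow> nat \<Rightarrow> nat \<Rightarrow> 'a" where
  "gauss_binomial q n 0 = 1"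
| "gauss_binomial q 0 (Suc k) = 0"
| "gauss_binomial q (Suc n) (Suc k) = gauss_binomial q n k + q ^ Suc k * gauss_binomial q n (Suc k)"

lemma gauss_binomial_eq_0: "n < k \<Longrightarrow> gauss_binomial q n k = 0"
  by (induction q n k rule: gauss_binomial.induct) auto

text \<open>The ratio of neighbouring binomials, cross-multiplied. It yields both the second
  q-Pascal rule and the product formula.\<close>

lemma gauss_binomial_absorb:
  "k \<le> n \<Longrightarrow> (1 - q ^ (n - k)) * gauss_binomial q n k = (1 - q ^ Suc k) * gauss_binomial q n (Suc k)"
proof (induction n arbitrary: k)
  case (Suc n)
  let ?g = "gauss_binomial q n"
  show ?case
  proof (cases k)
    case 0
    have "(1 - q ^ n) = (1 - q) * ?g 1"
      using Suc.IH[of 0] by simp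
    then have "q * ((1 - q) * ?g 1) = q * (1 - q ^ n)"
      by simp
    with 0 show ?thesis
      by (simp add: algebra_simps)
  next
    case (Suc l)
    have l: "l \<le> n"
      using Suc.prems Suc by simp
    have 1: "(1 - q ^ (n - l)) * ?g l = (1 - q ^ Suc l) * ?g (Suc l)"
      by (rule Suc.IH[OF l])
    have "(1 - q ^ (n - l)) * (?g l + q ^ Suc l * ?g (Suc l))
        = (1 - q ^ (n - l)) * ?g l + (1 - q ^ (n - l)) * q ^ Suc l * ?g (Suc l)"
      by (simp add: algebra_simps)
    also have "\<dots> = (1 - q ^ Suc l * q ^ (n - l)) * ?g (Suc l)"
      unfolding 1 by (simp add: algebra_simps)
    finally have "(1 - q ^ (n - l)) * (?g l + q ^ Suc l * ?g (Suc l))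
        = (1 - q ^ Suc l * q ^ (n - l)) * ?g (Suc l)" .
    moreover have "(1 - q ^ Suc (Suc l)) * (?g (Suc l) + q ^ Suc (Suc l) * ?g (Suc (Suc l)))
        = (1 - q ^ Suc l * q ^ (n - l)) * ?g (Suc l)"
    \<comment> \<open>The induction hypothesis at \<open>Suc l\<close> needs \<open>l < n\<close>;
      for \<open>l = n\<close> all binomials in the claim vanish.\<close>
    proof (cases "l = n")
      case False
      then have "(1 - q ^ (n - Suc l)) * ?g (Suc l) = (1 - q ^ Suc (Suc l)) * ?g (Suc (Suc l))"
        using l by (intro Suc.IH) simp
      then have "q ^ Suc (Suc l) * ((1 - q ^ (n - Suc l)) * ?g (Suc l))
          = q ^ Suc (Suc l) * ((1 - q ^ Suc (Suc l)) * ?g (Suc (Suc l)))"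
        by simp
      moreover have "q ^ (n - l) = q * q ^ (n - Suc l)"
        using False l by (metis Suc_diff_Suc le_neq_implies_less power_Suc)
      ultimately show ?thesis
        by (simp add: algebra_simps)
    qed (simp add: gauss_binomial_eq_0)
    ultimately show ?thesis
      using Suc by simp
  qed
qed simp

lemma gauss_binomial_Suc_Suc':
  "gauss_binomial q (Suc n) (Suc k) = q ^ (n - k) * gauss_binomial q n k + gauss_binomial q n (Suc k)"
  using gauss_binomial_absorb[of k n q]
  by (cases "k \<le> n") (simp_all add: gauss_binomial_eq_0 algebra_simps)

lemma gauss_binomial_qpoch:
  "k \<le> n \<Longrightarrow> gauss_binomial q n k * qpoch q k * qpoch q (n - k) = qpoch q n"
proof (induction n arbitrary: k)
  case (Suc n)
  let ?g = "gauss_binomial q n"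
  show ?case
  proof (cases k)
    case (Suc l)
    have l: "l \<le> n"
      using Suc.prems Suc by simp
    have 1: "?g l * qpoch q l * qpoch q (n - l) = qpoch q n"
      by (rule Suc.IH[OF l])
    have "?g (Suc l) * qpoch q (Suc l) * qpoch q (n - l) = (1 - q ^ (n - l)) * qpoch q n"
    proof -
      have "?g (Suc l) * qpoch q (Suc l) * qpoch q (n - l)
          = ((1 - q ^ Suc l) * ?g (Suc l)) * qpoch q l * qpoch q (n - l)"
        by (simp only: qpoch_Suc mult_ac)
      also have "\<dots> = ((1 - q ^ (n - l)) * ?g l) * qpoch q l * qpoch q (n - l)"
        by (simp only: gauss_binomial_absorb[OF l])
      also have "\<dots> = (1 - q ^ (n - l)) * (?g l * qpoch q l * qpoch q (n - l))"
        by (simp only: mult_ac)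
      finally show ?thesis
        by (simp only: 1)
    qed
    note 2 = this
    have "gauss_binomial q (Suc n) (Suc l) * qpoch q (Suc l) * qpoch q (n - l)
        = (1 - q ^ Suc l) * (?g l * qpoch q l * qpoch q (n - l))
          + q ^ Suc l * (?g (Suc l) * qpoch q (Suc l) * qpoch q (n - l))"
      by (simp add: algebra_simps)
    also have "\<dots> = (1 - q ^ Suc l) * qpoch q n + q ^ Suc l * ((1 - q ^ (n - l)) * qpoch q n)"
      by (simp only: 1 2)
    also have "\<dots> = qpoch q n * (1 - q ^ (Suc l + (n - l)))"
      by (simp only: power_add) (simp add: algebra_simps)
    finally show ?thesis
      using Suc l by simp
  qed simp
qed simp

text \<open>An integer lower index lets sums over \<open>j\<close> run past the support and be
  shifted.\<close>

definition gauss_binomial_int :: "'a :: comm_ring_1 \<Rightarrow> nat \<Rightarrow> int \<Rightarrow> 'a" where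
  "gauss_binomial_int q n i = (if i < 0 then 0 else gauss_binomial q n (nat i))"

lemma gauss_binomial_int_eq_0: "i < 0 \<or> i > int n \<Longrightarrow> gauss_binomial_int q n i = 0"
  by (auto simp: gauss_binomial_int_def gauss_binomial_eq_0)

text \<open>Where \<open>nat\<close> clips a negative exponent, the binomial multiplied by that
  power is zero.\<close>

lemma gauss_binomial_int_Suc:
  shows "gauss_binomial_int q (Suc n) i = gauss_binomial_int q n (i - 1) + q ^ nat i * gauss_binomial_int q n i"
    and "gauss_binomial_int q (Suc n) i =
      gauss_binomial_int q n i + q ^ nat (int n + 1 - i) * gauss_binomial_int q n (i - 1)"
proof -
  consider "i < 0" | "i = 0" | k where "i = int (Suc k)"
    by (metis int_cases less_linear negative_zless nonneg_int_cases not0_implies_Suc of_nat_0 of_nat_less_0_iff)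
  then have "gauss_binomial_int q (Suc n) i = gauss_binomial_int q n (i - 1) + q ^ nat i * gauss_binomial_int q n i
    \<and> gauss_binomial_int q (Suc n) i =
      gauss_binomial_int q n i + q ^ nat (int n + 1 - i) * gauss_binomial_int q n (i - 1)"
  proof cases
    case (3 k)
    moreover have "nat (int n + 1 - int (Suc k)) = n - k"
      by simp
    ultimately show ?thesis
      using gauss_binomial_Suc_Suc'[of q n k] by (simp add: gauss_binomial_int_def nat_add_distrib)
  qed (auto simp: gauss_binomial_int_def)
  then show "gauss_binomial_int q (Suc n) i = gauss_binomial_int q n (i - 1) + q ^ nat i * gauss_binomial_int q n i"
    and "gauss_binomial_int q (Suc n) i =
      gauss_binomial_int q n i + q ^ nat (int n + 1 - i) * gauss_binomial_int q n (i - 1)"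
    by blast+
qed

subsection \<open>The differentiated triple product\<close>

lemma minus_one_power_nat_abs: "(-1) ^ nat \<bar>j\<bar> = (if even j then 1 else - 1 :: int)"
  by (simp add: minus_one_power_iff even_nat_iff)

text \<open>\<open>jtp_even M j\<close> is the coefficient of \<open>z ^ j\<close> in
  \<open>\<Prod>i<M. (1 - z * q ^ (3 * i + 2)) * (1 - q ^ (3 * i + 1) / z)\<close>, and \<open>jtp_odd M j\<close> the one after
  multiplying by the further factor \<open>1 - z * q ^ (3 * M + 2)\<close>.\<close>

definition jtp_even :: "nat \<Rightarrow> int \<Rightarrow> rat fps" where
  "jtp_even M j = of_int ((-1) ^ nat \<bar>j\<bar>) * fps_X ^ nat (pent j) *
     gauss_binomial_int (fps_X ^ 3) (2 * M) (int M + j)"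

definition jtp_odd :: "nat \<Rightarrow> int \<Rightarrow> rat fps" where
  "jtp_odd M j = of_int ((-1) ^ nat \<bar>j\<bar>) * fps_X ^ nat (pent j) *
     gauss_binomial_int (fps_X ^ 3) (2 * M + 1) (int M + j)"

text \<open>The second q-Pascal rule, with exponents matched by
  \<open>pent j + 3 * (M + 1 - j) = 3 * M + 2 + pent (j - 1)\<close>; the minus sign is the parity
  change of \<open>j\<close>.\<close>

lemma jtp_odd_eq: "jtp_odd M j = jtp_even M j - fps_X ^ (3 * M + 2) * jtp_even M (j - 1)"
proof -
  let ?g = "gauss_binomial_int (fps_X ^ 3 :: rat fps) (2 * M)"
  have "fps_X ^ nat (pent j) * ((fps_X ^ 3) ^ nat (int M + 1 - j) * ?g (int M + j - 1))
      = fps_X ^ (3 * M + 2) * fps_X ^ nat (pent (j - 1)) * ?g (int M + j - 1)"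
  proof (cases "j \<le> int M + 1")
    case True
    have "pent j + 3 * (int M + 1 - j) = 3 * int M + 2 + pent (j - 1)"
      using two_pent[of j] two_pent[of "j - 1"] by (simp add: algebra_simps)
    then have "nat (pent j) + 3 * nat (int M + 1 - j) = 3 * M + 2 + nat (pent (j - 1))"
      using True pent_nonneg[of j] pent_nonneg[of "j - 1"] by (subst int_int_eq [symmetric]) simp
    then show ?thesis
      by (simp only: power_mult [symmetric] power_add [symmetric] mult.assoc [symmetric])
  qed (simp add: gauss_binomial_int_eq_0)
  note 1 = this
  have 2: "gauss_binomial_int (fps_X ^ 3 :: rat fps) (2 * M + 1) (int M + j)
      = ?g (int M + j) + (fps_X ^ 3) ^ nat (int M + 1 - j) * ?g (int M + j - 1)"
    using gauss_binomial_int_Suc(2)[of "fps_X ^ 3 :: rat fps" "2 * M" "int M + j"]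
    by (simp add: algebra_simps)
  have "jtp_odd M j = jtp_even M j + of_int ((-1) ^ nat \<bar>j\<bar>) *
      (fps_X ^ nat (pent j) * ((fps_X ^ 3) ^ nat (int M + 1 - j) * ?g (int M + j - 1)))"
    unfolding jtp_odd_def jtp_even_def 2 by (simp add: algebra_simps)
  then show ?thesis
    unfolding 1 by (simp add: jtp_even_def minus_one_power_nat_abs algebra_simps)
qed

text \<open>The mirror image: the first q-Pascal rule gives the factor
  \<open>1 - q ^ (3 * M + 1) / z\<close>.\<close>

lemma jtp_even_Suc_eq: "jtp_even (Suc M) j = jtp_odd M j - fps_X ^ (3 * M + 1) * jtp_odd M (j + 1)"
proof -
  let ?g = "gauss_binomial_int (fps_X ^ 3 :: rat fps) (2 * M + 1)"
  have "fps_X ^ nat (pent j) * ((fps_X ^ 3) ^ nat (int M + 1 + j) * ?g (int M + (j + 1)))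
      = fps_X ^ (3 * M + 1) * fps_X ^ nat (pent (j + 1)) * ?g (int M + (j + 1))"
  proof (cases "int M + 1 + j \<ge> 0")
    case True
    have "pent j + 3 * (int M + 1 + j) = 3 * int M + 1 + pent (j + 1)"
      using two_pent[of j] two_pent[of "j + 1"] by (simp add: algebra_simps)
    then have "nat (pent j) + 3 * nat (int M + 1 + j) = 3 * M + 1 + nat (pent (j + 1))"
      using True pent_nonneg[of j] pent_nonneg[of "j + 1"] by (subst int_int_eq [symmetric]) simp
    then show ?thesis
      by (simp only: power_mult [symmetric] power_add [symmetric] mult.assoc [symmetric])
  qed (simp add: gauss_binomial_int_eq_0)
  note 1 = this
  have 2: "gauss_binomial_int (fps_X ^ 3 :: rat fps) (2 * Suc M) (int (Suc M) + j)
      = ?g (int M + j) + (fps_X ^ 3) ^ nat (int M + 1 + j) * ?g (int M + (j + 1))"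
    using gauss_binomial_int_Suc(1)[of "fps_X ^ 3 :: rat fps" "2 * M + 1" "int (Suc M) + j"]
    by (simp add: algebra_simps)
  have "jtp_even (Suc M) j = jtp_odd M j + of_int ((-1) ^ nat \<bar>j\<bar>) *
      (fps_X ^ nat (pent j) * ((fps_X ^ 3) ^ nat (int M + 1 + j) * ?g (int M + (j + 1))))"
    unfolding jtp_odd_def jtp_even_def 2 by (simp add: algebra_simps)
  then show ?thesis
    unfolding 1 by (simp add: jtp_odd_def minus_one_power_nat_abs algebra_simps)
qed

text \<open>Terms pushed over the boundary vanish. The weight is constant for the value at z = 1 and
  proportional to \<open>j\<close> for the derivative.\<close>

lemma sum_shift_down:
  fixes f w :: "int \<Rightarrow> 'a :: comm_ring_1"
  assumes "\<And>j. \<bar>j\<bar> \<ge> L \<Longrightarrow> f j = 0"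
  shows "(\<Sum>j=-L..L. w j * f (j - 1)) = (\<Sum>j=-L..L. w (j + 1) * f j)"
  by (rule sum.reindex_bij_witness_not_neutral[where S' = "{-L}" and T' = "{L}"
        and i = "\<lambda>j. j + 1" and j = "\<lambda>j. j - 1"]) (auto simp: assms)

lemma sum_shift_up:
  fixes f w :: "int \<Rightarrow> 'a :: comm_ring_1"
  assumes "\<And>j. \<bar>j\<bar> \<ge> L \<Longrightarrow> f j = 0"
  shows "(\<Sum>j=-L..L. w j * f (j + 1)) = (\<Sum>j=-L..L. w (j - 1) * f j)"
  by (rule sum.reindex_bij_witness_not_neutral[where S' = "{L}" and T' = "{-L}"
        and i = "\<lambda>j. j - 1" and j = "\<lambda>j. j + 1"]) (auto simp: assms)

text \<open>Multiplication by \<open>1 - c * z\<close>, seen on the value and on the derivative at \<open>z = 1\<close> of a Laurent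
  polynomial with coefficients \<open>f j\<close>.\<close>

lemma moments_shift_down:
  fixes f :: "int \<Rightarrow> 'a :: comm_ring_1"
  assumes "\<And>j. \<bar>j\<bar> \<ge> L \<Longrightarrow> f j = 0"
  shows "(\<Sum>j=-L..L. f j - c * f (j - 1)) = (1 - c) * (\<Sum>j=-L..L. f j)"
    and "(\<Sum>j=-L..L. of_int j * (f j - c * f (j - 1)))
      = (1 - c) * (\<Sum>j=-L..L. of_int j * f j) - c * (\<Sum>j=-L..L. f j)"
proof -
  show "(\<Sum>j=-L..L. f j - c * f (j - 1)) = (1 - c) * (\<Sum>j=-L..L. f j)"
    using sum_shift_down[of L f "\<lambda>_. c", OF assms]
    by (simp add: sum_subtractf sum_distrib_left left_diff_distrib)
  show "(\<Sum>j=-L..L. of_int j * (f j - c * f (j - 1)))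
      = (1 - c) * (\<Sum>j=-L..L. of_int j * f j) - c * (\<Sum>j=-L..L. f j)"
    using sum_shift_down[of L f "\<lambda>j. of_int j * c", OF assms]
    by (simp add: sum_subtractf sum.distrib sum_distrib_left algebra_simps)
qed

lemma moments_shift_up:
  fixes f :: "int \<Rightarrow> 'a :: comm_ring_1"
  assumes "\<And>j. \<bar>j\<bar> \<ge> L \<Longrightarrow> f j = 0"
  shows "(\<Sum>j=-L..L. f j - c * f (j + 1)) = (1 - c) * (\<Sum>j=-L..L. f j)"
    and "(\<Sum>j=-L..L. of_int j * (f j - c * f (j + 1)))
      = (1 - c) * (\<Sum>j=-L..L. of_int j * f j) + c * (\<Sum>j=-L..L. f j)"
proof -
  show "(\<Sum>j=-L..L. f j - c * f (j + 1)) = (1 - c) * (\<Sum>j=-L..L. f j)"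
    using sum_shift_up[of L f "\<lambda>_. c", OF assms]
    by (simp add: sum_subtractf sum_distrib_left left_diff_distrib)
  show "(\<Sum>j=-L..L. of_int j * (f j - c * f (j + 1)))
      = (1 - c) * (\<Sum>j=-L..L. of_int j * f j) + c * (\<Sum>j=-L..L. f j)"
    using sum_shift_up[of L f "\<lambda>j. of_int j * c", OF assms]
    by (simp add: sum_subtractf sum.distrib sum_distrib_left algebra_simps)
qed

text \<open>The Lambert term \<open>q ^ r / (1 - q ^ r)\<close>.\<close>

definition multiples_fps :: "nat \<Rightarrow> rat fps" where
  "multiples_fps r = Abs_fps (\<lambda>n. if n > 0 \<and> r dvd n then 1 else 0)"

lemma multiples_fps_eq:
  assumes "r > 0"
  shows "(1 - fps_X ^ r) * multiples_fps r = fps_X ^ r"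
proof (rule fps_ext)
  fix n
  have "r dvd n - r \<longleftrightarrow> r dvd n" if "r \<le> n"
    using that by (simp add: dvd_minus_self)
  moreover have "\<not> r dvd n" if "0 < n" "n < r"
    using that by (auto dest: dvd_imp_le)
  ultimately show "fps_nth ((1 - fps_X ^ r) * multiples_fps r) n = fps_nth (fps_X ^ r) n"
    unfolding left_diff_distrib fps_sub_nth fps_X_power_mult_nth fps_X_power_nth multiples_fps_def
    using assms by auto
qed

definition jtp_prod :: "nat \<Rightarrow> rat fps" where
  "jtp_prod M = (\<Prod>i<M. (1 - fps_X ^ (3 * i + 1)) * (1 - fps_X ^ (3 * i + 2)))"

text \<open>The logarithmic derivative of the product at z = 1, a truncated Lambert series.\<close>

definition divisor_fps :: "nat \<Rightarrow> rat fps" where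
  "divisor_fps M = (\<Sum>i<M. multiples_fps (3 * i + 1) - multiples_fps (3 * i + 2))"

lemma jtp_moments:
  assumes "int M < L"
  shows "(\<Sum>j=-L..L. jtp_even M j) = jtp_prod M
    \<and> (\<Sum>j=-L..L. of_int j * jtp_even M j) = jtp_prod M * divisor_fps M"
  using assms
proof (induction M)
  case 0
  have "jtp_even 0 = (\<lambda>j. if j = 0 then 1 else 0)"
    by (auto simp: jtp_even_def gauss_binomial_int_def gauss_binomial_eq_0 pent_def)
  with 0 show ?case
    by (simp add: jtp_prod_def divisor_fps_def if_distrib cong: if_cong)
next
  case (Suc M)
  let ?a = "fps_X ^ (3 * M + 2) :: rat fps" and ?b = "fps_X ^ (3 * M + 1) :: rat fps"
  let ?A = "multiples_fps (3 * M + 2)" and ?B = "multiples_fps (3 * M + 1)"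
  have e: "jtp_even M j = 0" if "\<bar>j\<bar> \<ge> L" for j
  proof -
    have "gauss_binomial_int (fps_X ^ 3 :: rat fps) (2 * M) (int M + j) = 0"
      using that Suc.prems by (intro gauss_binomial_int_eq_0) arith
    then show ?thesis
      by (simp add: jtp_even_def)
  qed
  \<comment> \<open>The support of \<open>jtp_odd M\<close> reaches \<open>M + 1\<close>, still
    inside the range because \<open>Suc M < L\<close>.\<close>
  have o: "jtp_odd M j = 0" if "\<bar>j\<bar> \<ge> L" for j
  proof -
    have "gauss_binomial_int (fps_X ^ 3 :: rat fps) (2 * M + 1) (int M + j) = 0"
      using that Suc.prems by (intro gauss_binomial_int_eq_0) arith
    then show ?thesis
      by (simp add: jtp_odd_def)
  qed
  have IH: "(\<Sum>j=-L..L. jtp_even M j) = jtp_prod M"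
    "(\<Sum>j=-L..L. of_int j * jtp_even M j) = jtp_prod M * divisor_fps M"
    using Suc by auto
  have odd0: "(\<Sum>j=-L..L. jtp_odd M j) = (1 - ?a) * jtp_prod M"
    unfolding jtp_odd_eq by (simp only: moments_shift_down[of L "jtp_even M", OF e] IH)
  have odd1: "(\<Sum>j=-L..L. of_int j * jtp_odd M j)
      = (1 - ?a) * (jtp_prod M * divisor_fps M) - ?a * jtp_prod M"
    unfolding jtp_odd_eq by (simp only: moments_shift_down[of L "jtp_even M", OF e] IH)
  have A: "(1 - ?a) * ?A = ?a" and B: "(1 - ?b) * ?B = ?b"
    by (rule multiples_fps_eq; simp)+
  have P: "jtp_prod (Suc M) = (1 - ?b) * (1 - ?a) * jtp_prod M"
    by (simp add: jtp_prod_def mult_ac)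
  have D: "divisor_fps (Suc M) = divisor_fps M + (?B - ?A)"
    by (simp add: divisor_fps_def)
  have "(\<Sum>j=-L..L. jtp_even (Suc M) j) = (1 - ?b) * ((1 - ?a) * jtp_prod M)"
    unfolding jtp_even_Suc_eq by (simp only: moments_shift_up[of L "jtp_odd M", OF o] odd0)
  moreover have "(\<Sum>j=-L..L. of_int j * jtp_even (Suc M) j)
      = (1 - ?b) * ((1 - ?a) * (jtp_prod M * divisor_fps M) - ?a * jtp_prod M) + ?b * ((1 - ?a) * jtp_prod M)"
    unfolding jtp_even_Suc_eq by (simp only: moments_shift_up[of L "jtp_odd M", OF o] odd0 odd1)
  \<comment> \<open>The product rule, with a / (1 - a) and b / (1 - b) represented by
    \<open>x\<close> and \<open>y\<close>.\<close>
  moreover have "(1 - b) * ((1 - a) * (p * d) - a * p) + b * ((1 - a) * p)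
      = (1 - b) * (1 - a) * p * (d + (y - x))"
    if "(1 - a) * x = a" "(1 - b) * y = b" for a b p d x y :: "rat fps"
  proof -
    have "(1 - b) * (1 - a) * p * (d + (y - x))
        = (1 - b) * (1 - a) * (p * d) + (1 - a) * p * ((1 - b) * y) - (1 - b) * p * ((1 - a) * x)"
      by (simp add: algebra_simps)
    then show ?thesis
      unfolding that by (simp add: algebra_simps)
  qed
  ultimately show ?case
    unfolding P D using A B by (simp only: mult.assoc)
qed

text \<open>Sorts the factors of (q; q)_(3M) by the exponent modulo 3.\<close>

lemma jtp_prod_qpoch: "jtp_prod M * qpoch (fps_X ^ 3) M = qpoch fps_X (3 * M)"
proof (induction M)
  case (Suc M)
  have "jtp_prod (Suc M) * qpoch (fps_X ^ 3) (Suc M)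
      = (jtp_prod M * qpoch (fps_X ^ 3) M) * (1 - fps_X ^ (3 * M + 1)) * (1 - fps_X ^ (3 * M + 2))
        * (1 - (fps_X ^ 3) ^ Suc M)"
    by (simp add: jtp_prod_def mult_ac)
  also have "\<dots> = qpoch fps_X (3 * M) * (1 - fps_X ^ (3 * M + 1)) * (1 - fps_X ^ (3 * M + 2))
      * (1 - fps_X ^ (3 * M + 3))"
    unfolding Suc.IH power_mult [symmetric] by simp
  also have "\<dots> = qpoch fps_X (Suc (Suc (Suc (3 * M))))"
    by (simp only: qpoch_Suc) (simp add: numeral_2_eq_2 numeral_3_eq_3)
  finally show ?case
    by (simp add: numeral_3_eq_3 del: qpoch_Suc)
qed (simp add: jtp_prod_def)

section \<open>Passing from finite products to coefficients\<close>

lemma qpoch_cong: "a \<le> b \<Longrightarrow> q ^ Suc a dvd qpoch q b - qpoch q a"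
proof (induction b rule: dec_induct)
  case (step b)
  have "qpoch q (Suc b) - qpoch q a = (qpoch q b - qpoch q a) - qpoch q b * q ^ Suc b"
    by (simp add: algebra_simps)
  moreover have "q ^ Suc a dvd qpoch q b * q ^ Suc b"
    using step.hyps by (intro dvd_mult le_imp_power_dvd) simp
  ultimately show ?case
    using step.IH by (simp only: dvd_diff)
qed simp

text \<open>With q standing for \<open>fps_X ^ 3\<close>, every \<open>qpoch\<close> factor involved
  agrees with \<open>qpoch q a\<close> modulo \<open>q ^ Suc a\<close>. Cancelling this unit gives
  binomial times \<open>qpoch q M\<close> congruent to 1, and the factor
  \<open>fps_X ^ nat (pent j)\<close> makes up the missing degree.\<close>

lemma jtp_even_cong:
  assumes "\<bar>j\<bar> \<le> int M"
  shows "fps_X ^ (3 * M + 1) dvd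
    jtp_even M j * qpoch (fps_X ^ 3) M - of_int ((-1) ^ nat \<bar>j\<bar>) * fps_X ^ nat (pent j)"
proof -
  define a b where "a = M - nat \<bar>j\<bar>" and "b = M + nat \<bar>j\<bar>"
  define q where "q = (fps_X ^ 3 :: rat fps)"
  define g where "g = gauss_binomial_int q (2 * M) (int M + j)"
  have "g * qpoch q a * qpoch q b = qpoch q (2 * M)"
  proof (cases "j \<ge> 0")
    case True
    then have "nat (int M + j) = b" "2 * M - b = a"
      using assms by (simp_all add: a_def b_def nat_add_distrib)
    then show ?thesis
      using True gauss_binomial_qpoch[of b "2 * M" q] assms
      by (simp add: g_def gauss_binomial_int_def mult_ac b_def)
  next
    case False
    then have "nat (int M + j) = a" "2 * M - a = b" "a \<le> 2 * M"
      using assms by (simp_all add: a_def b_def)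
    then show ?thesis
      using False gauss_binomial_qpoch[of a "2 * M" q] assms
      by (simp add: g_def gauss_binomial_int_def)
  qed
  then have "qpoch q a * (g * qpoch q M - 1)
      = g * qpoch q a * ((qpoch q M - qpoch q a) - (qpoch q b - qpoch q a)) + (qpoch q (2 * M) - qpoch q a)"
    by (simp add: algebra_simps)
  moreover have "q ^ Suc a dvd qpoch q M - qpoch q a" "q ^ Suc a dvd qpoch q b - qpoch q a"
    "q ^ Suc a dvd qpoch q (2 * M) - qpoch q a"
    by (rule qpoch_cong; simp add: a_def b_def)+
  ultimately have "q ^ Suc a dvd qpoch q a * (g * qpoch q M - 1)"
    by (simp only: dvd_add dvd_diff dvd_mult)
  moreover have "fps_nth (qpoch q n) 0 = 1" for n
    by (induction n) (simp_all add: q_def fps_power_zeroth)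
  then have "qpoch q a dvd 1"
    by (simp add: fps_is_unit_iff)
  ultimately have "q ^ Suc a dvd g * qpoch q M - 1"
    by (simp add: dvd_mult_unit_iff' del: power_Suc)
  then have "fps_X ^ nat (pent j) * q ^ Suc a dvd
      of_int ((-1) ^ nat \<bar>j\<bar>) * (fps_X ^ nat (pent j) * (g * qpoch q M - 1))"
    by (intro dvd_mult mult_dvd_mono dvd_refl)
  moreover have "fps_X ^ nat (pent j) * q ^ Suc a = fps_X ^ (nat (pent j) + 3 * Suc a)"
    by (simp only: q_def power_mult [symmetric] power_add [symmetric])
  moreover have "3 * M + 1 \<le> nat (pent j) + 3 * Suc a"
  proof -
    have "3 * int M + 1 \<le> pent j + 3 * (int M - \<bar>j\<bar> + 1)"
    proof -
      \<comment> \<open>Expanded, this is \<open>3 * j * j - 7 * \<bar>j\<bar> + 4\<close>, at most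
        twice the slack. The roots 1 and 4/3 enclose no integer.\<close>
      have "0 \<le> (\<bar>j\<bar> - 1) * (3 * \<bar>j\<bar> - 4)"
        by (cases "\<bar>j\<bar> \<ge> 2"; cases "j = 0"; cases "\<bar>j\<bar> = 1") (auto intro: mult_nonneg_nonneg)
      moreover have "\<bar>j\<bar> * \<bar>j\<bar> = j * j"
        by simp
      ultimately show ?thesis
        using two_pent[of j] by (simp add: algebra_simps)
    qed
    then show ?thesis
      using assms pent_nonneg[of j] by (simp add: a_def of_nat_diff)
  qed
  then have "fps_X ^ (3 * M + 1) dvd (fps_X ^ (nat (pent j) + 3 * Suc a) :: rat fps)"
    by (rule le_imp_power_dvd)
  ultimately have "fps_X ^ (3 * M + 1) dvd
      of_int ((-1) ^ nat \<bar>j\<bar>) * (fps_X ^ nat (pent j) * (g * qpoch q M - 1))"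
    by (simp only: dvd_trans)
  also have "of_int ((-1) ^ nat \<bar>j\<bar>) * (fps_X ^ nat (pent j) * (g * qpoch q M - 1))
      = jtp_even M j * qpoch q M - of_int ((-1) ^ nat \<bar>j\<bar>) * fps_X ^ nat (pent j)"
    by (simp only: jtp_even_def g_def q_def right_diff_distrib mult.assoc mult_1_right)
  finally show ?thesis
    by (simp only: q_def)
qed

text \<open>Sum \<open>jtp_even_cong\<close> with weight \<open>j\<close>, insert
  \<open>jtp_moments\<close>, and cancel \<open>qpoch fps_X (3 * M)\<close> by its inverse.\<close>

lemma weighted_pentagonal_cong:
  "fps_X ^ (3 * M + 1) dvd divisor_fps M -
     partition_fps (3 * M) * (\<Sum>j=-int M..int M. of_int j * (of_int ((-1) ^ nat \<bar>j\<bar>) * fps_X ^ nat (pent j)))"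
proof -
  let ?t = "\<lambda>j. of_int ((-1) ^ nat \<bar>j\<bar>) * fps_X ^ nat (pent j) :: rat fps"
  let ?I = "{-int M..int M}" and ?Q = "qpoch (fps_X ^ 3) M :: rat fps"
  have "(\<Sum>j\<in>?I. of_int j * jtp_even M j)
      = (\<Sum>j\<in>{-(int M + 1)..int M + 1}. of_int j * jtp_even M j)"
    by (rule sum.mono_neutral_left) (auto simp: jtp_even_def gauss_binomial_int_eq_0)
  also have "\<dots> = jtp_prod M * divisor_fps M"
    using jtp_moments[of M "int M + 1"] by simp
  finally have 1: "(\<Sum>j\<in>?I. of_int j * jtp_even M j) = jtp_prod M * divisor_fps M" .
  have "(\<Sum>j\<in>?I. of_int j * (jtp_even M j * ?Q - ?t j))
      = (\<Sum>j\<in>?I. of_int j * jtp_even M j) * ?Q - (\<Sum>j\<in>?I. of_int j * ?t j)"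
    by (simp only: right_diff_distrib sum_subtractf sum_distrib_right mult.assoc)
  also have "\<dots> = (jtp_prod M * ?Q) * divisor_fps M - (\<Sum>j\<in>?I. of_int j * ?t j)"
    by (simp only: 1 mult_ac)
  finally have "(\<Sum>j\<in>?I. of_int j * (jtp_even M j * ?Q - ?t j))
      = (jtp_prod M * ?Q) * divisor_fps M - (\<Sum>j\<in>?I. of_int j * ?t j)" .
  moreover have "fps_X ^ (3 * M + 1) dvd (\<Sum>j\<in>?I. of_int j * (jtp_even M j * ?Q - ?t j))"
    by (intro dvd_sum dvd_mult jtp_even_cong) auto
  ultimately have "fps_X ^ (3 * M + 1) dvd qpoch fps_X (3 * M) * divisor_fps M - (\<Sum>j\<in>?I. of_int j * ?t j)"
    by (simp only: jtp_prod_qpoch)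
  then have "fps_X ^ (3 * M + 1) dvd partition_fps (3 * M) *
      (qpoch fps_X (3 * M) * divisor_fps M - (\<Sum>j\<in>?I. of_int j * ?t j))"
    by (rule dvd_mult)
  then show ?thesis
    by (simp only: right_diff_distrib mult.assoc [symmetric] partition_fps_times_qpoch mult_1_left)
qed

lemma residue_divisor_count_eq:
  assumes "n \<ge> 1" "n \<le> M" "r = 1 \<or> r = 2"
  shows "residue_divisor_count r 3 n = card {i\<in>{..<M}. 3 * i + r dvd n}"
proof -
  have div3: "3 * (d div 3) + r = d" if "[d = r] (mod 3)" for d
    using that assms(3) mult_div_mod_eq[of 3 d] by (auto simp: cong_def)
  have "bij_betw (\<lambda>i. 3 * i + r) {i\<in>{..<M}. 3 * i + r dvd n} {d. d > 0 \<and> d dvd n \<and> [d = r] (mod 3)}"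
  proof (rule bij_betw_byWitness[where f' = "\<lambda>d. d div 3"])
    show "(\<lambda>d. d div 3) ` {d. d > 0 \<and> d dvd n \<and> [d = r] (mod 3)} \<subseteq> {i\<in>{..<M}. 3 * i + r dvd n}"
    proof
      fix i assume "i \<in> (\<lambda>d. d div 3) ` {d. d > 0 \<and> d dvd n \<and> [d = r] (mod 3)}"
      then obtain d where d: "i = d div 3" "d > 0" "d dvd n" "[d = r] (mod 3)"
        by auto
      \<comment> \<open>Hence \<open>d div 3 < M\<close>: the truncation at \<open>M\<close> loses
        no divisor of \<open>n\<close>.\<close>
      then have "d \<le> n"
        using assms(1) by (auto dest: dvd_imp_le)
      with d div3[of d] assms show "i \<in> {i\<in>{..<M}. 3 * i + r dvd n}"
        by auto
    qed
    show "(\<lambda>i. 3 * i + r) ` {i\<in>{..<M}. 3 * i + r dvd n} \<subseteq> {d. d > 0 \<and> d dvd n \<and> [d = r] (mod 3)}"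
    proof -
      have "[3 * i + r = r] (mod 3)" for i
        by (simp add: cong_def)
      with assms(3) show ?thesis
        by auto
    qed
  qed (use assms(3) div3 in auto)
  then show ?thesis
    by (simp add: residue_divisor_count_def bij_betw_same_card)
qed

lemma divisor_fps_nth:
  assumes "n \<ge> 1" "n \<le> M"
  shows "fps_nth (divisor_fps M) n = of_nat (residue_divisor_count 1 3 n) - of_nat (residue_divisor_count 2 3 n)"
proof -
  have "(\<Sum>i<M. fps_nth (multiples_fps (3 * i + r)) n) = of_nat (card {i\<in>{..<M}. 3 * i + r dvd n})" for r
    using assms(1) by (simp add: multiples_fps_def sum.If_cases Int_def)
  from this[of 1] this[of 2] show ?thesis
    using residue_divisor_count_eq[OF assms, of 1] residue_divisor_count_eq[OF assms, of 2]
    by (simp add: divisor_fps_def fps_sum_nth sum_subtractf)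
qed

text \<open>Since \<open>n \<le> M < 3 * M + 1\<close>, the congruence is an equality at coefficient
  \<open>n\<close>, and \<open>partition_fps (3 * M)\<close> contributes true partition numbers
  there.\<close>

lemma weighted_pentagonal_sum:
  assumes "n \<ge> 1" "n \<le> M"
  shows "(\<Sum>j=-int M..int M. (-1) ^ nat \<bar>j\<bar> * j * int (partition_number (int n - pent j)))
    = int (residue_divisor_count 1 3 n) - int (residue_divisor_count 2 3 n)"
proof -
  let ?P = "partition_fps (3 * M)"
  have coeff: "fps_nth (?P * (of_int j * (of_int ((-1) ^ nat \<bar>j\<bar>) * fps_X ^ nat (pent j)))) n
      = of_int ((-1) ^ nat \<bar>j\<bar> * j * int (partition_number (int n - pent j)))" for j
  proof -
    let ?c = "of_int ((-1) ^ nat \<bar>j\<bar> * j) :: rat"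
    have "?P * (of_int j * (of_int ((-1) ^ nat \<bar>j\<bar>) * fps_X ^ nat (pent j)))
        = fps_const ?c * (fps_X ^ nat (pent j) * ?P)"
      by (simp only: of_int_mult fps_of_int [symmetric]) (simp add: mult_ac)
    moreover have "fps_nth (fps_X ^ nat (pent j) * ?P) n = of_nat (partition_number (int n - pent j))"
    proof (cases "n < nat (pent j)")
      case True
      then show ?thesis
        by (simp add: fps_X_power_mult_nth partition_number_neg)
    next
      case False
      then have "int (n - nat (pent j)) = int n - pent j"
        using pent_nonneg[of j] by linarith
      with False show ?thesis
        using assms pent_nonneg[of j]
        by (simp add: fps_X_power_mult_nth partition_fps_def card_bounded_partitions)
    qed
    ultimately have "fps_nth (?P * (of_int j * (of_int ((-1) ^ nat \<bar>j\<bar>) * fps_X ^ nat (pent j)))) n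
        = ?c * of_nat (partition_number (int n - pent j))"
      by (simp only: fps_mult_left_const_nth)
    then show ?thesis
      by (simp only: of_int_mult of_int_of_nat_eq)
  qed
  obtain h where h: "divisor_fps M -
      ?P * (\<Sum>j=-int M..int M. of_int j * (of_int ((-1) ^ nat \<bar>j\<bar>) * fps_X ^ nat (pent j)))
      = fps_X ^ (3 * M + 1) * h"
    using weighted_pentagonal_cong by (rule dvdE)
  have "fps_nth (fps_X ^ (3 * M + 1) * h) n = 0"
    using assms unfolding fps_X_power_mult_nth by simp
  then have "fps_nth (divisor_fps M) n = of_int (\<Sum>j=-int M..int M.
      (-1) ^ nat \<bar>j\<bar> * j * int (partition_number (int n - pent j)))"
    unfolding h [symmetric] fps_sub_nth sum_distrib_left fps_sum_nth coeff by simp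
  then have "(of_int (\<Sum>j=-int M..int M. (-1) ^ nat \<bar>j\<bar> * j * int (partition_number (int n - pent j))) :: rat)
      = of_int (int (residue_divisor_count 1 3 n) - int (residue_divisor_count 2 3 n))"
    unfolding divisor_fps_nth[OF assms] by simp
  then show ?thesis
    by (simp only: of_int_eq_iff)
qed

section \<open>Summation by parts and the sign of the tail\<close>

theorem corollary4:
  fixes k n :: nat
  assumes "k \<ge> 1" and "n \<ge> 1"
  shows "(odd k \<longrightarrow>
           (\<Sum>j = - int k..int k - 1.
              (-1) ^ nat \<bar>j\<bar> * j * int (partition_number (int n - j * (3 * j + 1) div 2)))
           \<ge> int (residue_divisor_count 1 3 n) - int (residue_divisor_count 2 3 n))
       \<and> (even k \<longrightarrow>
           (\<Sum>j = - int k..int k - 1.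
              (-1) ^ nat \<bar>j\<bar> * j * int (partition_number (int n - j * (3 * j + 1) div 2)))
           \<le> int (residue_divisor_count 1 3 n) - int (residue_divisor_count 2 3 n))"
proof -
  define p where "p j = int (partition_number (int n - pent j))" for j
  define S where "S k = (\<Sum>j = - int k..int k - 1. (-1) ^ nat \<bar>j\<bar> * j * p j)" for k
  define \<Delta> where "\<Delta> = int (residue_divisor_count 1 3 n) - int (residue_divisor_count 2 3 n)"
  define F where "F k = (-1) ^ k * (\<Delta> - S k)" for k
  \<comment> \<open>\<open>F k\<close> is \<open>k * p k + (\<Sum>i>k. (-1) ^ (i - k - 1) * i * (p (- i) - p i))\<close>, so summation by parts gives
    \<open>X k = (\<Sum>i>k. (-1) ^ (i - k - 1) * rank_tail i n)\<close>.\<close>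
  define X where "X k = int k * p (int k) + int (Suc k) * rank_tail k (int n) - F k" for k
  have p_nonneg: "p j \<ge> 0" for j
    by (simp add: p_def)
  have p_mono: "p i \<le> p j" if "pent j \<le> pent i" for i j
    using that by (simp add: p_def partition_number_mono)
  have pent_ge: "int k \<le> pent (int k)" "int k \<le> pent (- int k)" for k
  proof -
    have "int k * 1 \<le> int k * int k"
      by (cases k) auto
    then show "int k \<le> pent (int k)" "int k \<le> pent (- int k)"
      using two_pent[of "int k"] two_pent[of "- int k"] by (simp_all add: algebra_simps)
  qed
  have p_eq_0: "p (int k) = 0" "p (- int k) = 0" if "k > n" for k
    using that pent_ge[of k] by (simp_all add: p_def partition_number_neg)
  \<comment> \<open>The new indices are \<open>k\<close> and \<open>- (k + 1)\<close>; the negative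
    factor at the latter makes the two signs equal.\<close>
  have S_Suc: "S (Suc k) = S k + (-1) ^ k * (int k * p (int k) + int (Suc k) * p (- int (Suc k)))" for k
  proof -
    have "{- int (Suc k)..int (Suc k) - 1} = insert (int k) (insert (- int (Suc k)) {- int k..int k - 1})"
      by auto
    then show ?thesis
      by (simp add: S_def algebra_simps nat_add_distrib)
  qed
  \<comment> \<open>The window then holds every nonzero term; its unpaired index \<open>- k\<close>
    contributes zero.\<close>
  have S_eq: "S k = \<Delta>" if "k > n" for k
  proof -
    obtain M where k: "k = Suc M"
      using \<open>k > n\<close> by (cases k) auto
    have "{- int k..int k - 1} = insert (- int k) {- int M..int M}"
      by (auto simp: k)
    moreover have "(\<Sum>j=-int M..int M. (-1) ^ nat \<bar>j\<bar> * j * p j) = \<Delta>"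
      using that assms(2) weighted_pentagonal_sum[of n M] by (simp add: k p_def \<Delta>_def)
    ultimately show ?thesis
      using p_eq_0(2)[OF that] by (simp add: S_def k)
  qed
  have rank_tail_eq_0: "rank_tail k (int n) = 0" if "k > n" for k
  proof -
    have "partitions (int n - pent (- int k)) = {}" "partitions (int n - pent (- int k) - int k) = {}"
      using that pent_ge(2)[of k] by (auto simp: partitions_def)
    then show ?thesis
      by (simp add: rank_tail_def rank_ge_count_def)
  qed
  have X_rec: "X k + X (Suc k) = rank_tail (Suc k) (int n)" for k
  proof -
    have "F k + F (Suc k) = (-1) ^ k * (S (Suc k) - S k)"
      by (simp add: F_def algebra_simps)
    also have "\<dots> = ((-1) ^ k * (-1) ^ k) * (int k * p (int k) + int (Suc k) * p (- int (Suc k)))"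
      by (simp only: S_Suc add_diff_cancel_left' mult.assoc)
    also have "(-1) ^ k * (-1) ^ k = (1 :: int)"
      by (simp flip: power_add)
    finally have F: "F k + F (Suc k) = int k * p (int k) + int (Suc k) * p (- int (Suc k))"
      by simp
    have R: "rank_tail (Suc k) (int n) = p (- int (Suc k)) - p (int (Suc k)) - rank_tail k (int n)"
      using rank_tail_rec[of k "int n"] by (simp add: p_def)
    have "X k + X (Suc k) = int k * p (int k) + int (Suc k) * rank_tail k (int n)
        + int (Suc k) * p (int (Suc k)) + int (Suc (Suc k)) * rank_tail (Suc k) (int n) - (F k + F (Suc k))"
      by (simp add: X_def)
    also have "\<dots> = rank_tail (Suc k) (int n)"
      unfolding F R by (simp add: algebra_simps)
    finally show ?thesis .
  qed
  \<comment> \<open>Descending induction in steps of two from \<open>X k = 0\<close> for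
    \<open>k > n\<close>. By \<open>rank_tail_rec\<close>, the difference of two tails is at most
    \<open>p (- (k + 2)) - p (k + 2)\<close>, and the subtracted term absorbs the bound on
    \<open>X (k + 2)\<close>.\<close>
  have X_le: "X k \<le> p (- int (k + 2))" for k
  proof (induction k rule: measure_induct_rule[of "\<lambda>k. Suc n - k"])
    case (less k)
    show ?case
    proof (cases "k > n")
      case True
      then show ?thesis
        using p_nonneg by (simp add: X_def F_def S_eq p_eq_0 rank_tail_eq_0)
    next
      case False
      have "X (k + 2) \<le> p (- int (k + 2 + 2))"
        using False by (intro less) simp
      also have "\<dots> \<le> p (int (k + 2))"
        using two_pent[of "int (k + 2)"] two_pent[of "- int (k + 2 + 2)"]
        by (intro p_mono) (simp add: algebra_simps)
      finally have "X (k + 2) \<le> p (int (k + 2))" .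
      moreover have "X k = rank_tail (Suc k) (int n) - rank_tail (k + 2) (int n) + X (k + 2)"
        using X_rec[of k] X_rec[of "Suc k"] by simp
      moreover have "rank_tail (Suc k) (int n) + rank_tail (k + 2) (int n) = p (- int (k + 2)) - p (int (k + 2))"
        using rank_tail_rec[of "Suc k" "int n"] by (simp add: p_def)
      ultimately show ?thesis
        using rank_tail_nonneg[of "k + 2" "int n"] by linarith
    qed
  qed
  have "X k \<le> p (int k)"
    using two_pent[of "int k"] two_pent[of "- int (k + 2)"]
    by (intro order_trans[OF X_le] p_mono) (simp add: algebra_simps)
  \<comment> \<open>Here \<open>k \<ge> 1\<close> enters: the leading term of \<open>F k\<close>
    dominates \<open>X k\<close>.\<close>
  also have "\<dots> \<le> int k * p (int k)"
    using mult_right_mono[of 1 "int k" "p (int k)"] assms(1) p_nonneg by simp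
  finally have "F k \<ge> int (Suc k) * rank_tail k (int n)"
    by (simp add: X_def)
  moreover have "int (Suc k) * rank_tail k (int n) \<ge> 0"
    by (intro mult_nonneg_nonneg rank_tail_nonneg) simp
  ultimately have "F k \<ge> 0"
    by linarith
  \<comment> \<open>The sign in \<open>F\<close> merges both parities into one inequality.\<close>
  then have "(odd k \<longrightarrow> S k \<ge> \<Delta>) \<and> (even k \<longrightarrow> S k \<le> \<Delta>)"
    by (auto simp: F_def)
  then show ?thesis
    by (simp add: S_def p_def \<Delta>_def pent_def)
qed

end
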